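(* Let $\alpha:I\to\mathbb{R}^3$ be a nonplanar arclength parametrized curve with curvature $\kappa_\alpha>0$ and torsion $\tau_\alpha$ (nowhere zero). Then $\alpha$ is an osculating helix with $W$ orthogonal to $V$ (that is, there exist a unit $F$-constant osculating vector field $W$ along $\alpha$ and a nonzero constant vector $V\in\mathbb{R}^3$ with $\langle W(s),V\rangle=0$ for all $s\in I$) if and only if there is a nonzero constant $\theta\in[-\pi/2,\pi/2]$ such that $$\frac{\tau_\alpha}{\kappa_\alpha^2+\sin^2\theta\,\tau_\alpha^2}\left(\frac{\kappa_\alpha}{\tau_\alpha}\right)'=\cot\theta$$ on $I$.
   Context: $I$ is an open interval and all curves and functions are smooth ($C^\infty$). For an arclength parametrized curve $\alpha:I\to\mathbb{R}^3$ with $\kappa_\alpha>0$, the Frenet frame $\{T_\alpha,N_\alpha,B_\alpha\}$ satisfies $T_\alpha'=\kappa_\alpha N_\alpha$, $N_\alpha'=-\kappa_\alpha T_\alpha+\tau_\alpha B_\alpha$, $B_\alpha'=-\tau_\alpha N_\alpha$. Here $\cot\theta=\cos\theta/\sin\theta$, so $\cot(\pm\pi/2)=0$. A vector field $W$ along $\alpha$ is called $F$-constant (with respect to the Frenet frame) if $W'=D_\alpha\times W$, where $D_\alpha=\tau_\alpha T_\alpha+\kappa_\alpha B_\alpha$ is the Darboux vector; equivalently, $W=aT_\alpha+bN_\alpha+cB_\alpha$ with real constants $a,b,c$. It is osculating if $W(s)$ lies in the osculating plane $\mathrm{span}\{T_\alpha(s),N_\alpha(s)\}$ for every $s$. A curve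 $\alpha$ is a helix if there is a (without loss of generality unit) $F$-constant vector field $W$ along $\alpha$ forming a constant angle with a fixed direction $V$ (a nonzero constant vector), called an axis; it is an osculating helix if $W$ is an osculating vector field. *)

theory Defs
  imports "HOL-Analysis.Analysis"
begin

text \<open>
  Maps are total on \<^typ>\<open>real\<close>, but all conditions are imposed only on the
  parameter interval \<open>I\<close>.  Since \<open>I\<close> is always open, derivatives at points of \<open>I\<close>
  do not depend on the values outside \<open>I\<close>.
\<close>

definition smooth_on :: "real set \<Rightarrow> (real \<Rightarrow> 'a::real_normed_vector) \<Rightarrow> bool" where
  "smooth_on I f \<longleftrightarrow>
     (\<forall>n. \<forall>s\<in>I. ((\<lambda>g t. vector_derivative g (at t)) ^^ n) f differentiable (at s))"

definition arclength_curve :: "real set \<Rightarrow> (real \<Rightarrow> real^3) \<Rightarrow> bool" where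
  "arclength_curve I \<alpha> \<longleftrightarrow>
     smooth_on I \<alpha> \<and> (\<forall>s\<in>I. norm (vector_derivative \<alpha> (at s)) = 1)"

definition planar_on :: "real set \<Rightarrow> (real \<Rightarrow> real^3) \<Rightarrow> bool" where
  "planar_on I \<alpha> \<longleftrightarrow> (\<exists>p n. n \<noteq> 0 \<and> (\<forall>s\<in>I. (\<alpha> s - p) \<bullet> n = 0))"

definition tangent :: "(real \<Rightarrow> real^3) \<Rightarrow> real \<Rightarrow> real^3" where
  "tangent \<alpha> s = vector_derivative \<alpha> (at s)"

definition curvature :: "(real \<Rightarrow> real^3) \<Rightarrow> real \<Rightarrow> real" where
  "curvature \<alpha> s = norm (vector_derivative (tangent \<alpha>) (at s))"

definition normal :: "(real \<Rightarrow> real^3) \<Rightarrow> real \<Rightarrow> real^3" where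
  "normal \<alpha> s = (1 / curvature \<alpha> s) *\<^sub>R vector_derivative (tangent \<alpha>) (at s)"

definition binormal :: "(real \<Rightarrow> real^3) \<Rightarrow> real \<Rightarrow> real^3" where
  "binormal \<alpha> s = cross3 (tangent \<alpha> s) (normal \<alpha> s)"

text \<open>The sign convention is that of the Frenet equation \<open>B' = - \<tau> N\<close>.\<close>

definition torsion :: "(real \<Rightarrow> real^3) \<Rightarrow> real \<Rightarrow> real" where
  "torsion \<alpha> s = - (vector_derivative (binormal \<alpha>) (at s) \<bullet> normal \<alpha> s)"

definition darboux :: "(real \<Rightarrow> real^3) \<Rightarrow> real \<Rightarrow> real^3" where
  "darboux \<alpha> s = torsion \<alpha> s *\<^sub>R tangent \<alpha> s + curvature \<alpha> s *\<^sub>R binormal \<alpha> s"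

definition F_constant :: "real set \<Rightarrow> (real \<Rightarrow> real^3) \<Rightarrow> (real \<Rightarrow> real^3) \<Rightarrow> bool" where
  "F_constant I \<alpha> W \<longleftrightarrow> smooth_on I W \<and>
     (\<forall>s\<in>I. vector_derivative W (at s) = cross3 (darboux \<alpha> s) (W s))"

definition osculating :: "real set \<Rightarrow> (real \<Rightarrow> real^3) \<Rightarrow> (real \<Rightarrow> real^3) \<Rightarrow> bool" where
  "osculating I \<alpha> W \<longleftrightarrow> (\<forall>s\<in>I. W s \<in> span {tangent \<alpha> s, normal \<alpha> s})"

end

theory Submission
  imports Defs
begin

text \<open>
  A unit osculating F-constant field is \<open>W = a T + b N\<close> with constants \<open>a\<^sup>2 + b\<^sup>2 = 1\<close>: the inner
  product of two F-constant fields is constant, because both turn with the same angular velocity,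
  and \<open>T\<close> and \<open>N\<close> are themselves F-constant. Everything is then a statement about the ratio
  \<open>r = \<kappa> / \<tau>\<close>: a nonzero fixed vector orthogonal to \<open>W\<close> exists iff \<open>b \<noteq> 0\<close> and
  \<open>r' = (a / b) \<tau> (r\<^sup>2 + b\<^sup>2)\<close>,
  which is the equation of the theorem with \<open>a = cos \<theta>\<close>, \<open>b = sin \<theta>\<close>, cleared of denominators
  (\<open>ratio_ode_iff\<close>).

  If \<open>V\<close> is orthogonal to \<open>W\<close>, then \<open>\<langle>W, V\<rangle> = 0\<close> and its derivative express \<open>\<langle>N, V\<rangle>\<close> and \<open>\<langle>B, V\<rangle>\<close>
  through \<open>\<langle>T, V\<rangle>\<close>, and differentiating the expression for \<open>\<langle>B, V\<rangle>\<close> gives the equation for \<open>r\<close>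
  (\<open>orthogonal_axis_imp_ratio_ode\<close>). The same relations show that \<open>V\<close> must be a multiple of
  \<open>- b\<^sup>2 T + a b N - r B\<close>, with a factor \<open>m\<close> satisfying \<open>m' = - (a / b) \<kappa> m\<close>. By the equation for
  \<open>r\<close>, the function \<open>(r\<^sup>2 + b\<^sup>2) powr (- 1 / 2)\<close> is such a factor, so that the axis can be written
  down without an integration (\<open>ratio_ode_imp_orthogonal_axis\<close>).

  F-constant fields are required to be smooth, so the converse also uses that \<open>N = (1 / \<kappa>) T'\<close> is
  smooth; this follows from the closure of smooth functions under products and, for positive \<open>f\<close>,
  under \<open>f \<mapsto> 1 / \<surd>f\<close>.
\<close>

section \<open>Smooth functions on an open set\<close>

text \<open>
  Smoothness is the conjunction over all finite orders. Closure properties are proved order by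
  order, and peeling off the innermost derivative gives the recursion which these inductions follow.
\<close>

primrec differentiable_times :: "nat \<Rightarrow> real set \<Rightarrow> (real \<Rightarrow> 'a::real_normed_vector) \<Rightarrow> bool" where
  "differentiable_times 0 I f \<longleftrightarrow> True"
| "differentiable_times (Suc n) I f \<longleftrightarrow>
     (\<forall>s\<in>I. f differentiable (at s)) \<and> differentiable_times n I (\<lambda>t. vector_derivative f (at t))"

lemma differentiable_times_iff:
  "differentiable_times n I f \<longleftrightarrow>
     (\<forall>m<n. \<forall>s\<in>I. ((\<lambda>g t. vector_derivative g (at t)) ^^ m) f differentiable (at s))"
proof (induction n arbitrary: f)
  case (Suc n)
  show ?case
    by (simp add: Suc All_less_Suc2 funpow_Suc_right[unfolded o_def] del: funpow.simps(2))
qed simp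

lemma smooth_on_iff: "smooth_on I f \<longleftrightarrow> (\<forall>n. differentiable_times n I f)"
  unfolding smooth_on_def differentiable_times_iff by blast

lemma smooth_on_differentiable: "smooth_on I f \<Longrightarrow> s \<in> I \<Longrightarrow> f differentiable (at s)"
  unfolding smooth_on_iff by (metis differentiable_times.simps(2))

lemma smooth_on_has_vector_derivative:
  "smooth_on I f \<Longrightarrow> s \<in> I \<Longrightarrow> (f has_vector_derivative vector_derivative f (at s)) (at s)"
  using smooth_on_differentiable vector_derivative_works by blast

lemma smooth_on_vector_derivative:
  "smooth_on I f \<Longrightarrow> smooth_on I (\<lambda>t. vector_derivative f (at t))"
  unfolding smooth_on_iff by (metis differentiable_times.simps(2))

lemma differentiable_times_mono:
  "differentiable_times n I f \<Longrightarrow> m \<le> n \<Longrightarrow> differentiable_times m I f"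
  unfolding differentiable_times_iff by auto

lemma differentiable_times_cong:
  assumes "open I" "\<And>t. t \<in> I \<Longrightarrow> f t = g t" "differentiable_times n I f"
  shows "differentiable_times n I g"
  using assms(2,3)
proof (induction n arbitrary: f g)
  case (Suc n)
  have d: "(g has_vector_derivative vector_derivative f (at s)) (at s)" if "s \<in> I" for s
  proof (rule has_vector_derivative_transform_within_open[OF _ assms(1) that])
    show "(f has_vector_derivative vector_derivative f (at s)) (at s)"
      using Suc.prems(2) that by (simp add: vector_derivative_works[symmetric])
  qed (rule Suc.prems(1))
  have "differentiable_times n I (\<lambda>t. vector_derivative g (at t))"
    by (rule Suc.IH[of "\<lambda>t. vector_derivative f (at t)"])
       (use Suc.prems(2) vector_derivative_at[OF d] in simp_all)
  then show ?case using differentiableI_vector[OF d] by simp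
qed simp

lemma smooth_on_cong:
  "open I \<Longrightarrow> (\<And>t. t \<in> I \<Longrightarrow> f t = g t) \<Longrightarrow> smooth_on I f \<Longrightarrow> smooth_on I g"
  unfolding smooth_on_iff by (simp add: differentiable_times_cong[of I f g])

text \<open>
  The derivative need only be known on \<open>I\<close>; this is how an explicit formula for a derivative enters
  an induction over the order.
\<close>
lemma differentiable_times_SucI:
  assumes "open I" "\<And>s. s \<in> I \<Longrightarrow> (f has_vector_derivative f' s) (at s)"
    and "differentiable_times n I f'"
  shows "differentiable_times (Suc n) I f"
proof -
  have "differentiable_times n I (\<lambda>t. vector_derivative f (at t))"
    by (rule differentiable_times_cong[OF assms(1) _ assms(3)])
       (simp add: vector_derivative_at[OF assms(2)])
  then show ?thesis using differentiableI_vector[OF assms(2)] by simp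
qed

lemma differentiable_times_SucD:
  assumes "differentiable_times (Suc n) I f" "s \<in> I"
  shows "(f has_vector_derivative vector_derivative f (at s)) (at s)"
  using assms by (simp add: vector_derivative_works[symmetric])

lemma smooth_on_const: "smooth_on I (\<lambda>_. c)"
proof -
  have "differentiable_times n I (\<lambda>_. c)" for n
    by (induction n arbitrary: c) auto
  then show ?thesis by (simp add: smooth_on_iff)
qed

lemma differentiable_times_add:
  assumes "open I" "differentiable_times n I f" "differentiable_times n I g"
  shows "differentiable_times n I (\<lambda>t. f t + g t)"
  using assms(2,3)
proof (induction n arbitrary: f g)
  case (Suc n)
  show ?case
    by (rule differentiable_times_SucI[OF assms(1)
          has_vector_derivative_add[OF
            differentiable_times_SucD[OF Suc.prems(1)] differentiable_times_SucD[OF Suc.prems(2)]]])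
       (use Suc in simp_all)
qed simp

lemma smooth_on_add: "open I \<Longrightarrow> smooth_on I f \<Longrightarrow> smooth_on I g \<Longrightarrow> smooth_on I (\<lambda>t. f t + g t)"
  unfolding smooth_on_iff using differentiable_times_add by blast

lemma (in bounded_bilinear) differentiable_times:
  assumes "open I" "differentiable_times n I f" "differentiable_times n I g"
  shows "differentiable_times n I (\<lambda>t. prod (f t) (g t))"
  using assms(2,3)
proof (induction n arbitrary: f g)
  case (Suc n)
  have m: "differentiable_times n I f" "differentiable_times n I g"
    using Suc.prems differentiable_times_mono le_SucI by blast+
  show ?case
    by (rule differentiable_times_SucI[OF assms(1)
          has_vector_derivative[OF
            differentiable_times_SucD[OF Suc.prems(1)] differentiable_times_SucD[OF Suc.prems(2)]]])
       (use Suc m in \<open>auto intro!: differentiable_times_add assms(1)\<close>)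
qed simp

lemma (in bounded_bilinear) smooth_on:
  "open I \<Longrightarrow> smooth_on I f \<Longrightarrow> smooth_on I g \<Longrightarrow> smooth_on I (\<lambda>t. prod (f t) (g t))"
  unfolding smooth_on_iff using differentiable_times by blast

lemma has_real_derivative_inverse_sqrt:
  fixes g :: "real \<Rightarrow> real"
  defines "h \<equiv> \<lambda>t. 1 / sqrt (g t)"
  assumes "(g has_real_derivative g') (at s)" "g s > 0"
  shows "(h has_real_derivative (-1/2) * (h s * (h s * (h s * g')))) (at s)"
  using assms(3) unfolding h_def
  by (auto intro!: derivative_eq_intros assms(2) simp: field_simps)

text \<open>The derivative of \<open>h = 1/\<surd>f\<close> is \<open>- h\<^sup>3 f' / 2\<close>, a polynomial in \<open>h\<close> and \<open>f'\<close>, so each order of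
  differentiability of \<open>h\<close> yields the next one.\<close>
lemma smooth_on_inverse_sqrt:
  fixes f :: "real \<Rightarrow> real"
  assumes "open I" "smooth_on I f" "\<And>s. s \<in> I \<Longrightarrow> f s > 0"
  shows "smooth_on I (\<lambda>t. 1 / sqrt (f t))"
proof -
  let ?h = "\<lambda>t. 1 / sqrt (f t)" and ?f' = "\<lambda>t. vector_derivative f (at t)"
  have d: "(?h has_vector_derivative (-1/2) * (?h s * (?h s * (?h s * ?f' s)))) (at s)"
    if "s \<in> I" for s
  proof -
    have f: "(f has_real_derivative ?f' s) (at s)"
      using smooth_on_has_vector_derivative[OF assms(2) that]
      by (simp add: has_real_derivative_iff_has_vector_derivative)
    show ?thesis
      using has_real_derivative_inverse_sqrt[OF f assms(3)[OF that]]
      by (simp only: has_real_derivative_iff_has_vector_derivative)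
  qed
  have "differentiable_times n I ?h" for n
  proof (induction n)
    case (Suc n)
    have c: "differentiable_times n I (\<lambda>t. -1/2 :: real)" "differentiable_times n I ?f'"
      using smooth_on_const smooth_on_vector_derivative[OF assms(2)]
      unfolding smooth_on_iff by blast+
    note mult = bounded_bilinear.differentiable_times[OF bounded_bilinear_mult assms(1)]
    show ?case
      by (rule differentiable_times_SucI[OF assms(1) d]) (assumption, intro mult Suc.IH c)
  qed simp
  then show ?thesis by (simp add: smooth_on_iff)
qed


section \<open>The Frenet equations\<close>

text \<open>
  The difference \<open>y\<close> of the two sides is orthogonal to \<open>w = u \<times> v\<close>, and \<open>y \<times> (u \<times> v) = 0\<close> by Lagrange's
  identity because \<open>y\<close> is orthogonal to \<open>u\<close> and \<open>v\<close>; so \<open>y\<close> is both orthogonal and parallel to the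
  unit vector \<open>w\<close>.
\<close>
lemma orthonormal_cross3_expansion:
  fixes u v x :: "real^3"
  assumes "u \<bullet> u = 1" "v \<bullet> v = 1" "u \<bullet> v = 0"
  shows "x = (x \<bullet> u) *\<^sub>R u + (x \<bullet> v) *\<^sub>R v + (x \<bullet> cross3 u v) *\<^sub>R cross3 u v"
proof -
  let ?w = "cross3 u v"
  let ?y = "x - ((x \<bullet> u) *\<^sub>R u + (x \<bullet> v) *\<^sub>R v + (x \<bullet> ?w) *\<^sub>R ?w)"
  have w: "?w \<bullet> ?w = 1"
    using norm_cross_dot[of u v] assms
    by (simp add: power2_norm_eq_inner[symmetric] power_mult_distrib)
  have o: "u \<bullet> ?w = 0" "v \<bullet> ?w = 0" "?w \<bullet> u = 0" "?w \<bullet> v = 0"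
    by (simp_all add: dot_cross_self)
  have y: "?y \<bullet> u = 0" "?y \<bullet> v = 0" "?y \<bullet> ?w = 0"
    using assms w o by (simp_all add: inner_diff_left inner_add_left inner_commute[of v u])
  have "cross3 ?y ?w = 0" using y by (simp add: Lagrange)
  then have "norm ?y * norm ?w = 0"
    using norm_and_cross_eq_0[of ?y ?w] y(3) by auto
  moreover have "norm ?w = 1" using w by (simp add: norm_eq_sqrt_inner)
  ultimately have "?y = 0" by simp
  then show ?thesis by simp
qed

locale frenet_curve =
  fixes I :: "real set" and \<alpha> :: "real \<Rightarrow> real^3"
  assumes interval_I: "is_interval I"
    and open_I: "open I"
    and nonempty_I: "I \<noteq> {}"
    and arclength: "arclength_curve I \<alpha>"
    and curvature_pos: "s \<in> I \<Longrightarrow> curvature \<alpha> s > 0"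
    and torsion_nonzero: "s \<in> I \<Longrightarrow> torsion \<alpha> s \<noteq> 0"
begin

abbreviation "T \<equiv> tangent \<alpha>"
abbreviation "N \<equiv> normal \<alpha>"
abbreviation "B \<equiv> binormal \<alpha>"
abbreviation "\<kappa> \<equiv> curvature \<alpha>"
abbreviation "\<tau> \<equiv> torsion \<alpha>"

lemma smooth_T: "smooth_on I T"
  using arclength smooth_on_vector_derivative[of I \<alpha>]
  by (simp add: arclength_curve_def tangent_def[abs_def])

lemma curvature_eq: "\<kappa> s = sqrt (vector_derivative T (at s) \<bullet> vector_derivative T (at s))"
  by (simp add: curvature_def norm_eq_sqrt_inner)

lemma smooth_inverse_curvature: "smooth_on I (\<lambda>t. 1 / \<kappa> t)"
  unfolding curvature_eq
  by (intro smooth_on_inverse_sqrt bounded_bilinear.smooth_on[OF bounded_bilinear_inner]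
      open_I smooth_on_vector_derivative smooth_T)
     (use curvature_pos in \<open>simp add: curvature_eq\<close>)

lemma smooth_N: "smooth_on I N"
  unfolding normal_def[abs_def]
  by (intro bounded_bilinear.smooth_on[OF bounded_bilinear_scaleR]
      open_I smooth_on_vector_derivative smooth_T smooth_inverse_curvature)

lemma smooth_B: "smooth_on I B"
  unfolding binormal_def[abs_def]
  by (intro bounded_bilinear.smooth_on[OF bilinear_conv_bounded_bilinear[THEN iffD1, OF bilinear_cross]]
      open_I smooth_T smooth_N)

lemma T_unit: "s \<in> I \<Longrightarrow> T s \<bullet> T s = 1"
  using arclength by (simp add: arclength_curve_def tangent_def norm_eq_1)

lemma T_derivative: "s \<in> I \<Longrightarrow> (T has_vector_derivative \<kappa> s *\<^sub>R N s) (at s)"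
  using smooth_on_has_vector_derivative[OF smooth_T] curvature_pos[of s]
  by (simp add: normal_def)

lemma N_derivative0: "s \<in> I \<Longrightarrow> (N has_vector_derivative vector_derivative N (at s)) (at s)"
  by (rule smooth_on_has_vector_derivative[OF smooth_N])

lemma B_derivative0: "s \<in> I \<Longrightarrow> (B has_vector_derivative vector_derivative B (at s)) (at s)"
  by (rule smooth_on_has_vector_derivative[OF smooth_B])

lemma N_unit: "s \<in> I \<Longrightarrow> N s \<bullet> N s = 1"
  using curvature_pos[of s]
  by (simp add: normal_def curvature_def power2_norm_eq_inner[symmetric] power2_eq_square)

lemma inner_constant_derivative:
  assumes "\<And>t. t \<in> I \<Longrightarrow> f t \<bullet> g t = c" "s \<in> I"
    and "(f has_vector_derivative f') (at s)" "(g has_vector_derivative g') (at s)"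
  shows "f s \<bullet> g' + f' \<bullet> (g s :: 'a :: real_inner) = 0"
proof -
  have "((\<lambda>t. f t \<bullet> g t) has_vector_derivative (f s \<bullet> g' + f' \<bullet> g s)) (at s)"
    by (rule bounded_bilinear.has_vector_derivative[OF bounded_bilinear_inner assms(3,4)])
  moreover have "((\<lambda>t. f t \<bullet> g t) has_vector_derivative 0) (at s)"
    by (rule has_vector_derivative_transform_within_open[OF has_vector_derivative_const[of c] open_I assms(2)])
       (simp add: assms(1))
  ultimately show ?thesis using vector_derivative_unique_at by blast
qed

lemma T_N_orthogonal: assumes "s \<in> I" shows "T s \<bullet> N s = 0"
proof -
  have "T s \<bullet> (\<kappa> s *\<^sub>R N s) + (\<kappa> s *\<^sub>R N s) \<bullet> T s = 0"
    by (rule inner_constant_derivative[OF T_unit assms T_derivative T_derivative]) (use assms in auto)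
  then show ?thesis using curvature_pos[OF assms] by (simp add: inner_commute)
qed

lemma B_orthogonal: "T s \<bullet> B s = 0" "N s \<bullet> B s = 0"
  by (simp_all add: binormal_def dot_cross_self)

lemma B_unit: "s \<in> I \<Longrightarrow> B s \<bullet> B s = 1"
  using norm_cross_dot[of "T s" "N s"] T_unit N_unit T_N_orthogonal
  by (simp add: binormal_def power2_norm_eq_inner[symmetric] power_mult_distrib)

lemmas frame_inner = T_unit N_unit B_unit T_N_orthogonal B_orthogonal
  T_N_orthogonal[unfolded inner_commute[of "T _"]]
  B_orthogonal[unfolded inner_commute[of _ "B _"]]

lemma frame_expansion:
  "s \<in> I \<Longrightarrow> x = (x \<bullet> T s) *\<^sub>R T s + (x \<bullet> N s) *\<^sub>R N s + (x \<bullet> B s) *\<^sub>R B s"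
  unfolding binormal_def
  by (rule orthonormal_cross3_expansion[OF T_unit N_unit T_N_orthogonal])

lemma N_derivative:
  assumes "s \<in> I"
  shows "(N has_vector_derivative - \<kappa> s *\<^sub>R T s + \<tau> s *\<^sub>R B s) (at s)"
proof -
  let ?n = "vector_derivative N (at s)"
  have "T s \<bullet> ?n + (\<kappa> s *\<^sub>R N s) \<bullet> N s = 0"
    by (rule inner_constant_derivative[OF T_N_orthogonal assms T_derivative N_derivative0])
       (use assms in auto)
  then have nT: "?n \<bullet> T s = - \<kappa> s"
    using assms by (simp add: frame_inner inner_commute)
  have "N s \<bullet> ?n + ?n \<bullet> N s = 0"
    by (rule inner_constant_derivative[OF N_unit assms N_derivative0 N_derivative0])
       (use assms in auto)
  then have nN: "?n \<bullet> N s = 0" by (simp add: inner_commute)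
  have "N s \<bullet> vector_derivative B (at s) + ?n \<bullet> B s = 0"
    by (rule inner_constant_derivative[OF B_orthogonal(2) assms N_derivative0 B_derivative0])
       (use assms in auto)
  then have nB: "?n \<bullet> B s = \<tau> s" by (simp add: torsion_def inner_commute)
  have "?n = - \<kappa> s *\<^sub>R T s + \<tau> s *\<^sub>R B s"
    using frame_expansion[OF assms, of ?n] by (simp add: nT nN nB)
  then show ?thesis using N_derivative0[OF assms] by simp
qed

lemma B_derivative:
  assumes "s \<in> I"
  shows "(B has_vector_derivative - \<tau> s *\<^sub>R N s) (at s)"
proof -
  let ?b = "vector_derivative B (at s)"
  have "T s \<bullet> ?b + (\<kappa> s *\<^sub>R N s) \<bullet> B s = 0"
    by (rule inner_constant_derivative[OF B_orthogonal(1) assms T_derivative B_derivative0])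
       (use assms in auto)
  then have "T s \<bullet> ?b = 0" by (simp add: B_orthogonal)
  then have bT: "?b \<bullet> T s = 0" by (simp add: inner_commute)
  have bN: "?b \<bullet> N s = - \<tau> s" by (simp add: torsion_def)
  have "B s \<bullet> ?b + ?b \<bullet> B s = 0"
    by (rule inner_constant_derivative[OF B_unit assms B_derivative0 B_derivative0])
       (use assms in auto)
  then have bB: "?b \<bullet> B s = 0" by (simp add: inner_commute)
  have "?b = - \<tau> s *\<^sub>R N s"
    using frame_expansion[OF assms, of ?b] by (simp add: bT bN bB)
  then show ?thesis using B_derivative0[OF assms] by simp
qed

text \<open>
  Curvature and torsion are smooth as components of \<open>T'\<close> and \<open>N'\<close> in the frame; this makes their
  ratio differentiable.
\<close>
lemma smooth_curvature: "smooth_on I \<kappa>"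
proof (rule smooth_on_cong[OF open_I])
  show "smooth_on I (\<lambda>t. vector_derivative T (at t) \<bullet> N t)"
    by (intro bounded_bilinear.smooth_on[OF bounded_bilinear_inner] open_I
        smooth_on_vector_derivative smooth_T smooth_N)
  show "vector_derivative T (at t) \<bullet> N t = \<kappa> t" if "t \<in> I" for t
    using that by (simp add: vector_derivative_at[OF T_derivative] frame_inner)
qed

lemma smooth_torsion: "smooth_on I \<tau>"
proof (rule smooth_on_cong[OF open_I])
  show "smooth_on I (\<lambda>t. vector_derivative N (at t) \<bullet> B t)"
    by (intro bounded_bilinear.smooth_on[OF bounded_bilinear_inner] open_I
        smooth_on_vector_derivative smooth_N smooth_B)
  show "vector_derivative N (at t) \<bullet> B t = \<tau> t" if "t \<in> I" for t
    using that by (simp add: vector_derivative_at[OF N_derivative] frame_inner inner_diff_left)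
qed

lemma ratio_derivative:
  assumes "s \<in> I"
  shows "((\<lambda>t. \<kappa> t / \<tau> t) has_real_derivative deriv (\<lambda>t. \<kappa> t / \<tau> t) s) (at s)"
proof -
  have "\<kappa> differentiable (at s)" "\<tau> differentiable (at s)"
    using assms smooth_curvature smooth_torsion smooth_on_differentiable by blast+
  then have "(\<lambda>t. \<kappa> t / \<tau> t) differentiable (at s)"
    using torsion_nonzero[OF assms] by simp
  then show ?thesis
    by (simp add: DERIV_deriv_iff_real_differentiable)
qed

lemma darboux_cross:
  assumes "s \<in> I"
  shows "cross3 (darboux \<alpha> s) (T s) = \<kappa> s *\<^sub>R N s"
    and "cross3 (darboux \<alpha> s) (N s) = - \<kappa> s *\<^sub>R T s + \<tau> s *\<^sub>R B s"
proof -
  have BT: "cross3 (B s) (T s) = N s"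
    using assms Lagrange[of "T s" "T s" "N s"]
    by (simp add: binormal_def cross_skew[of "cross3 _ _"] frame_inner)
  have BN: "cross3 (B s) (N s) = - T s"
    using assms Lagrange[of "N s" "T s" "N s"]
    by (simp add: binormal_def cross_skew[of "cross3 _ _"] frame_inner)
  show "cross3 (darboux \<alpha> s) (T s) = \<kappa> s *\<^sub>R N s"
    by (simp add: darboux_def cross_add_left cross_mult_left BT)
  show "cross3 (darboux \<alpha> s) (N s) = - \<kappa> s *\<^sub>R T s + \<tau> s *\<^sub>R B s"
    by (simp add: darboux_def cross_add_left cross_mult_left BN binormal_def[symmetric])
qed


section \<open>Osculating F-constant fields\<close>

lemma constant_of_zero_derivative:
  fixes f :: "real \<Rightarrow> 'b::real_normed_vector"
  assumes "\<And>s. s \<in> I \<Longrightarrow> (f has_vector_derivative 0) (at s)"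
  shows "\<exists>c. \<forall>s\<in>I. f s = c"
proof -
  have "convex I" using interval_I by (rule is_interval_convex)
  then show ?thesis
    by (rule has_vector_derivative_zero_constant)
       (use assms has_vector_derivative_at_within in blast)+
qed

lemma F_constant_linear_combination: "F_constant I \<alpha> (\<lambda>t. a *\<^sub>R T t + b *\<^sub>R N t)"
  unfolding F_constant_def
proof (intro conjI ballI)
  show "smooth_on I (\<lambda>t. a *\<^sub>R T t + b *\<^sub>R N t)"
    by (intro smooth_on_add bounded_bilinear.smooth_on[OF bounded_bilinear_scaleR]
        smooth_on_const open_I smooth_T smooth_N)
  fix s assume s: "s \<in> I"
  have "((\<lambda>t. a *\<^sub>R T t + b *\<^sub>R N t) has_vector_derivative
      a *\<^sub>R (\<kappa> s *\<^sub>R N s) + b *\<^sub>R (- \<kappa> s *\<^sub>R T s + \<tau> s *\<^sub>R B s)) (at s)"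
    by (intro has_vector_derivative_add
        bounded_linear.has_vector_derivative[OF bounded_linear_scaleR_right]
        T_derivative N_derivative s)
  then show "vector_derivative (\<lambda>t. a *\<^sub>R T t + b *\<^sub>R N t) (at s) =
      cross3 (darboux \<alpha> s) (a *\<^sub>R T s + b *\<^sub>R N s)"
    by (simp add: vector_derivative_at cross_add_right cross_mult_right darboux_cross[OF s])
qed

text \<open>
  F-constant fields solve \<open>X' = D \<times> X\<close>, and \<open>x \<mapsto> D \<times> x\<close> is skew-adjoint.
\<close>
lemma F_constant_inner_constant:
  assumes "F_constant I \<alpha> U" "F_constant I \<alpha> W"
  shows "\<exists>c. \<forall>s\<in>I. U s \<bullet> W s = c"
proof (rule constant_of_zero_derivative)
  fix s assume s: "s \<in> I"
  have d: "(X has_vector_derivative cross3 (darboux \<alpha> s) (X s)) (at s)"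
    if "F_constant I \<alpha> X" for X
    using that smooth_on_has_vector_derivative[of I X s] s by (simp add: F_constant_def)
  have "((\<lambda>t. U t \<bullet> W t) has_vector_derivative
      U s \<bullet> cross3 (darboux \<alpha> s) (W s) + cross3 (darboux \<alpha> s) (U s) \<bullet> W s) (at s)"
    by (rule bounded_bilinear.has_vector_derivative[OF bounded_bilinear_inner d d]) fact+
  moreover have "x \<bullet> cross3 z y + cross3 z x \<bullet> y = 0" for x y z :: "real^3"
    by (simp add: cross3_simps)
  ultimately show "((\<lambda>t. U t \<bullet> W t) has_vector_derivative 0) (at s)" by simp
qed

text \<open>
  Pairing \<open>W\<close> with the F-constant fields \<open>T\<close> and \<open>N\<close> yields the constants; the third component
  vanishes since the osculating plane is orthogonal to \<open>B\<close>.
\<close>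
lemma osculating_F_constant_unit:
  assumes "F_constant I \<alpha> W" "osculating I \<alpha> W" "\<forall>s\<in>I. norm (W s) = 1"
  obtains a b where "a\<^sup>2 + b\<^sup>2 = 1" "\<And>s. s \<in> I \<Longrightarrow> W s = a *\<^sub>R T s + b *\<^sub>R N s"
proof -
  obtain a where a: "\<forall>s\<in>I. W s \<bullet> T s = a"
    using F_constant_inner_constant[OF assms(1) F_constant_linear_combination[of 1 0]] by auto
  obtain b where b: "\<forall>s\<in>I. W s \<bullet> N s = b"
    using F_constant_inner_constant[OF assms(1) F_constant_linear_combination[of 0 1]] by auto
  have W: "W s = a *\<^sub>R T s + b *\<^sub>R N s" if s: "s \<in> I" for s
  proof -
    have "W s \<in> span {T s, N s}" using assms(2) s by (simp add: osculating_def)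
    then have "orthogonal (B s) (W s)"
      by (rule orthogonal_to_span) (use s in \<open>auto simp: orthogonal_def frame_inner\<close>)
    then have "W s \<bullet> B s = 0" by (simp add: orthogonal_def inner_commute)
    then show ?thesis using frame_expansion[OF s, of "W s"] a b s by simp
  qed
  obtain s where s: "s \<in> I" using nonempty_I by blast
  have "W s \<bullet> W s = 1" using assms(3) s by (simp add: norm_eq_1)
  then have "a\<^sup>2 + b\<^sup>2 = 1"
    using s by (simp add: W[OF s] frame_inner inner_add_left inner_add_right power2_eq_square)
  then show ?thesis using W that by blast
qed

abbreviation "ratio \<equiv> (\<lambda>t. \<kappa> t / \<tau> t)"

text \<open>
  The components of \<open>V\<close> in the frame satisfy \<open>a \<langle>T, V\<rangle> + b \<langle>N, V\<rangle> = 0\<close>. Its derivative becomes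
  \<open>b\<^sup>2 \<langle>B, V\<rangle> = r \<langle>T, V\<rangle>\<close> after multiplication by \<open>b\<close> and elimination of \<open>\<langle>N, V\<rangle>\<close>, and the derivative
  of that relation, with \<open>\<langle>N, V\<rangle>\<close> eliminated again, is the claimed equation multiplied by \<open>\<langle>T, V\<rangle>\<close>. For \<open>b = 0\<close> the field \<open>W = \<plusminus> T\<close> would be
  orthogonal to \<open>V\<close>, hence by the Frenet equations so would \<open>N\<close> and \<open>B\<close>, and \<open>V\<close> would vanish.
\<close>
lemma orthogonal_axis_imp_ratio_ode:
  assumes ab: "a\<^sup>2 + b\<^sup>2 = 1" and V: "V \<noteq> 0"
    and orth: "\<And>s. s \<in> I \<Longrightarrow> (a *\<^sub>R T s + b *\<^sub>R N s) \<bullet> V = 0"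
  shows "b \<noteq> 0" and "\<And>s. s \<in> I \<Longrightarrow> deriv ratio s = a / b * (\<tau> s * ((ratio s)\<^sup>2 + b\<^sup>2))"
proof -
  note const = has_vector_derivative_const[of V]
  note smult = bounded_linear.has_vector_derivative[OF bounded_linear_scaleR_right]
  have first: "a * (\<kappa> s * (N s \<bullet> V)) + b * (\<tau> s * (B s \<bullet> V) - \<kappa> s * (T s \<bullet> V)) = 0"
    if s: "s \<in> I" for s
  proof -
    have "(a *\<^sub>R T s + b *\<^sub>R N s) \<bullet> 0 +
        (a *\<^sub>R (\<kappa> s *\<^sub>R N s) + b *\<^sub>R (- \<kappa> s *\<^sub>R T s + \<tau> s *\<^sub>R B s)) \<bullet> V = 0"
      by (rule inner_constant_derivative[OF orth s
            has_vector_derivative_add[OF smult[OF T_derivative[OF s]] smult[OF N_derivative[OF s]]]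
            const])
    then show ?thesis by (simp add: inner_add_left algebra_simps)
  qed
  have orth': "a * (T s \<bullet> V) + b * (N s \<bullet> V) = 0" if "s \<in> I" for s
    using orth[OF that] by (simp add: inner_add_left)
  have component: "T s \<bullet> V \<noteq> 0 \<or> N s \<bullet> V \<noteq> 0 \<or> B s \<bullet> V \<noteq> 0" if "s \<in> I" for s
    using frame_expansion[OF that, of V] V by (auto simp: inner_commute)
  show b: "b \<noteq> 0"
  proof
    assume "b = 0"
    then have a: "a \<noteq> 0" using ab by auto
    have T0: "T s \<bullet> V = 0" if "s \<in> I" for s using orth'[OF that] a \<open>b = 0\<close> by simp
    have N0: "N s \<bullet> V = 0" if "s \<in> I" for s
      using first[OF that] a \<open>b = 0\<close> curvature_pos[OF that] by simp
    obtain s where s: "s \<in> I" using nonempty_I by blast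
    have "N s \<bullet> 0 + (- \<kappa> s *\<^sub>R T s + \<tau> s *\<^sub>R B s) \<bullet> V = 0"
      by (rule inner_constant_derivative[OF N0 s N_derivative[OF s] const])
    then have "B s \<bullet> V = 0" using T0 s torsion_nonzero[OF s] by (simp add: inner_diff_left)
    then show False using component T0 N0 s by blast
  qed
  have B_T: "(b\<^sup>2 *\<^sub>R B s - ratio s *\<^sub>R T s) \<bullet> V = 0" if s: "s \<in> I" for s
  proof -
    have "b * (a * (\<kappa> s * (N s \<bullet> V)) + b * (\<tau> s * (B s \<bullet> V) - \<kappa> s * (T s \<bullet> V))) = 0"
      using first[OF s] by simp
    then have "b\<^sup>2 * (\<tau> s * (B s \<bullet> V)) = \<kappa> s * (b\<^sup>2 * (T s \<bullet> V) - a * (b * (N s \<bullet> V)))"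
      by (simp add: algebra_simps power2_eq_square)
    also have "b * (N s \<bullet> V) = - a * (T s \<bullet> V)" using orth'[OF s] by simp
    also have "b\<^sup>2 * (T s \<bullet> V) - a * (- a * (T s \<bullet> V)) = (a\<^sup>2 + b\<^sup>2) * (T s \<bullet> V)"
      by (simp add: algebra_simps power2_eq_square)
    finally show ?thesis
      using ab torsion_nonzero[OF s] by (simp add: inner_diff_left field_simps)
  qed
  fix s assume s: "s \<in> I"
  let ?r' = "deriv ratio s"
  have r: "(ratio has_vector_derivative ?r') (at s)"
    using ratio_derivative[OF s] by (simp add: has_real_derivative_iff_has_vector_derivative)
  \<comment> \<open>All components of \<open>V\<close> are proportional to \<open>\<langle>T, V\<rangle>\<close>, which may therefore be cancelled.\<close>
  have T_nz: "T s \<bullet> V \<noteq> 0"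
  proof
    assume "T s \<bullet> V = 0"
    then have "N s \<bullet> V = 0" "B s \<bullet> V = 0"
      using orth'[OF s] B_T[OF s] b by (auto simp: inner_diff_left)
    then show False using component[OF s] \<open>T s \<bullet> V = 0\<close> by blast
  qed
  have "(b\<^sup>2 *\<^sub>R B s - ratio s *\<^sub>R T s) \<bullet> 0 +
      (b\<^sup>2 *\<^sub>R (- \<tau> s *\<^sub>R N s) - (ratio s *\<^sub>R (\<kappa> s *\<^sub>R N s) + ?r' *\<^sub>R T s)) \<bullet> V = 0"
    by (rule inner_constant_derivative[OF B_T s has_vector_derivative_diff[OF
            smult[OF B_derivative[OF s]]
            bounded_bilinear.has_vector_derivative[OF bounded_bilinear_scaleR r T_derivative[OF s]]]
          const])
  then have "?r' * (T s \<bullet> V) = - (N s \<bullet> V) * (b\<^sup>2 * \<tau> s + ratio s * \<kappa> s)"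
    by (simp add: inner_diff_left inner_add_left algebra_simps)
  then have "b * (?r' * (T s \<bullet> V)) = - (b * (N s \<bullet> V)) * (b\<^sup>2 * \<tau> s + ratio s * \<kappa> s)"
    by simp
  also have "- (b * (N s \<bullet> V)) = a * (T s \<bullet> V)" using orth'[OF s] by simp
  finally have "(T s \<bullet> V) * (b * ?r') = (T s \<bullet> V) * (a * (b\<^sup>2 * \<tau> s + ratio s * \<kappa> s))"
    by (simp only: mult.assoc mult.commute mult.left_commute)
  then have "b * ?r' = a * (b\<^sup>2 * \<tau> s + ratio s * \<kappa> s)"
    using T_nz by (simp only: mult_cancel_left) simp
  also have "b\<^sup>2 * \<tau> s + ratio s * \<kappa> s = \<tau> s * ((ratio s)\<^sup>2 + b\<^sup>2)"
    using torsion_nonzero[OF s] by (simp add: field_simps power2_eq_square)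
  finally have "b * ?r' / b = a * (\<tau> s * ((ratio s)\<^sup>2 + b\<^sup>2)) / b" by (simp only:)
  then show "?r' = a / b * (\<tau> s * ((ratio s)\<^sup>2 + b\<^sup>2))" using b by simp
qed

text \<open>
  The vector field \<open>V\<close> below is orthogonal to \<open>a T + b N\<close> by its form. With \<open>\<kappa> = r \<tau>\<close>, the three
  frame components of \<open>V'\<close> vanish separately: the \<open>T\<close> component by the equation for \<open>m'\<close>, the \<open>N\<close>
  component because \<open>a\<^sup>2 + b\<^sup>2 = 1\<close>, and the \<open>B\<close> component by the equation for \<open>r\<close>.
\<close>
lemma ratio_ode_imp_orthogonal_axis:
  assumes ab: "a\<^sup>2 + b\<^sup>2 = 1" and b: "b \<noteq> 0"
    and ode: "\<And>s. s \<in> I \<Longrightarrow> deriv ratio s = a / b * (\<tau> s * ((ratio s)\<^sup>2 + b\<^sup>2))"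
  obtains V where "V \<noteq> 0" "\<And>s. s \<in> I \<Longrightarrow> (a *\<^sub>R T s + b *\<^sub>R N s) \<bullet> V = 0"
proof -
  define m where "m t = 1 / sqrt ((ratio t)\<^sup>2 + b\<^sup>2)" for t
  define V where "V t = m t *\<^sub>R ((- b\<^sup>2) *\<^sub>R T t + (a * b) *\<^sub>R N t - ratio t *\<^sub>R B t)" for t
  have pos: "(ratio t)\<^sup>2 + b\<^sup>2 > 0" for t using b by (simp add: add_nonneg_pos)
  have "(V has_vector_derivative 0) (at s)" if s: "s \<in> I" for s
  proof -
    define r where "r = ratio s"
    have \<kappa>: "\<kappa> s = r * \<tau> s" using torsion_nonzero[OF s] by (simp add: r_def)
    define r' where "r' = a / b * (\<tau> s * (r\<^sup>2 + b\<^sup>2))"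
    have r: "(ratio has_real_derivative r') (at s)"
      using ratio_derivative[OF s] ode[OF s] by (simp add: r'_def r_def)
    have q: "((\<lambda>t. (ratio t)\<^sup>2 + b\<^sup>2) has_real_derivative 2 * r * r') (at s)"
      using DERIV_add[OF DERIV_power[OF r, of 2] DERIV_const[of "b\<^sup>2"]]
      by (simp add: r_def mult.commute mult.left_commute)
    have "m s * m s = 1 / (r\<^sup>2 + b\<^sup>2)" using pos[of s] by (simp add: m_def r_def)
    then have "m s * (m s * (m s * (2 * r * r'))) = 1 / (r\<^sup>2 + b\<^sup>2) * (m s * (2 * r * r'))"
      by (metis mult.assoc)
    then have "(-1/2) * (m s * (m s * (m s * (2 * r * r')))) = - (a / b * r * \<tau> s * m s)"
      using pos[of s] by (simp add: r'_def r_def)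
    then have m: "(m has_vector_derivative - (a / b * r * \<tau> s * m s)) (at s)"
      using has_real_derivative_inverse_sqrt[OF q pos]
      unfolding m_def[abs_def] has_real_derivative_iff_has_vector_derivative by simp
    note smult = bounded_linear.has_vector_derivative[OF bounded_linear_scaleR_right]
    note scale = bounded_bilinear.has_vector_derivative[OF bounded_bilinear_scaleR]
    have "(V has_vector_derivative
        m s *\<^sub>R ((- b\<^sup>2) *\<^sub>R (\<kappa> s *\<^sub>R N s) + (a * b) *\<^sub>R (- \<kappa> s *\<^sub>R T s + \<tau> s *\<^sub>R B s)
          - (ratio s *\<^sub>R (- \<tau> s *\<^sub>R N s) + r' *\<^sub>R B s))
        + (- (a / b * r * \<tau> s * m s)) *\<^sub>R ((- b\<^sup>2) *\<^sub>R T s + (a * b) *\<^sub>R N s - ratio s *\<^sub>R B s)) (at s)"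
      (is "(V has_vector_derivative ?V') (at s)")
      unfolding V_def[abs_def]
      by (rule scale[OF m has_vector_derivative_diff[OF has_vector_derivative_add[OF
              smult[OF T_derivative[OF s]] smult[OF N_derivative[OF s]]]
            scale[OF r[unfolded has_real_derivative_iff_has_vector_derivative] B_derivative[OF s]]]])
    also have "?V' = (m s * \<tau> s * r * (a / b * b\<^sup>2 - a * b)) *\<^sub>R T s
        + (m s * \<tau> s * r * (1 - b\<^sup>2 - a / b * (a * b))) *\<^sub>R N s
        + (m s * (a * b * \<tau> s - r' + a / b * \<tau> s * r\<^sup>2)) *\<^sub>R B s"
      unfolding r_def[symmetric] \<kappa> by (simp add: algebra_simps power2_eq_square)
    also have "a / b * b\<^sup>2 - a * b = 0" using b by (simp add: power2_eq_square)
    also have "1 - b\<^sup>2 - a / b * (a * b) = 0" using b ab by (simp add: power2_eq_square)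
    also have "a * b * \<tau> s - r' + a / b * \<tau> s * r\<^sup>2 = 0"
      using b by (simp add: r'_def field_simps power2_eq_square)
    finally show ?thesis by simp
  qed
  then obtain v where v: "\<forall>s\<in>I. V s = v" using constant_of_zero_derivative by blast
  show ?thesis
  proof (rule that[of v])
    obtain s where s: "s \<in> I" using nonempty_I by blast
    have "V s \<bullet> T s = - (m s * b\<^sup>2)"
      using s by (simp add: V_def frame_inner inner_add_left inner_diff_left)
    moreover have "m s > 0" using pos[of s] by (simp add: m_def)
    ultimately show "v \<noteq> 0" using v s b by auto
  next
    fix s assume s: "s \<in> I"
    have "(a *\<^sub>R T s + b *\<^sub>R N s) \<bullet> V s = 0"
      using s by (simp add: V_def frame_inner inner_add_left inner_add_right inner_diff_right
          power2_eq_square)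
    then show "(a *\<^sub>R T s + b *\<^sub>R N s) \<bullet> v = 0" using v s by simp
  qed
qed

lemma ratio_ode_iff:
  assumes "s \<in> I" "b \<noteq> 0"
  shows "\<tau> s / ((\<kappa> s)\<^sup>2 + b\<^sup>2 * (\<tau> s)\<^sup>2) * deriv ratio s = a / b \<longleftrightarrow>
    deriv ratio s = a / b * (\<tau> s * ((ratio s)\<^sup>2 + b\<^sup>2))"
proof -
  let ?q = "(\<kappa> s)\<^sup>2 + b\<^sup>2 * (\<tau> s)\<^sup>2"
  have t: "\<tau> s \<noteq> 0" using assms(1) by (rule torsion_nonzero)
  have q: "?q \<noteq> 0"
    using curvature_pos[OF assms(1)] by (simp add: add_pos_nonneg less_imp_neq[symmetric])
  have "\<tau> s * ((ratio s)\<^sup>2 + b\<^sup>2) = ?q / \<tau> s"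
    using t by (simp add: field_simps power2_eq_square)
  moreover have "\<tau> s / ?q * x = y \<longleftrightarrow> x = y * (?q / \<tau> s)" for x y
    using t q by (auto simp: field_simps)
  ultimately show ?thesis by simp
qed

end

section \<open>The characterization\<close>

theorem theorem3p1:
  fixes I :: "real set" and \<alpha> :: "real \<Rightarrow> real^3"
  assumes "is_interval I" and "open I"
    and "arclength_curve I \<alpha>"
    and "\<not> planar_on I \<alpha>"
    and "\<forall>s\<in>I. curvature \<alpha> s > 0"
    and "\<forall>s\<in>I. torsion \<alpha> s \<noteq> 0"
  shows "(\<exists>W V. F_constant I \<alpha> W \<and> (\<forall>s\<in>I. norm (W s) = 1) \<and> osculating I \<alpha> W \<and>
            V \<noteq> 0 \<and> (\<forall>s\<in>I. W s \<bullet> V = 0))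
     \<longleftrightarrow> (\<exists>\<theta>\<in>{-pi/2..pi/2}. \<theta> \<noteq> 0 \<and>
            (\<forall>s\<in>I. torsion \<alpha> s / ((curvature \<alpha> s)\<^sup>2 + (sin \<theta>)\<^sup>2 * (torsion \<alpha> s)\<^sup>2)
                     * deriv (\<lambda>t. curvature \<alpha> t / torsion \<alpha> t) s = cot \<theta>))"
    (is "?helix \<longleftrightarrow> ?ode")
proof -
  have "I \<noteq> {}"
    using assms(4) by (auto simp: planar_on_def intro!: exI[of _ "axis 1 1"] simp: axis_eq_0_iff)
  then interpret frenet_curve I \<alpha>
    by unfold_locales (use assms in auto)
  show ?thesis
  proof
    assume ?helix
    then obtain W V where W: "F_constant I \<alpha> W" "osculating I \<alpha> W" "\<forall>s\<in>I. norm (W s) = 1"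
      and V: "V \<noteq> 0" "\<forall>s\<in>I. W s \<bullet> V = 0"
      by blast
    from W obtain a b where ab: "a\<^sup>2 + b\<^sup>2 = 1"
      and W_eq: "\<And>s. s \<in> I \<Longrightarrow> W s = a *\<^sub>R T s + b *\<^sub>R N s"
      by (rule osculating_F_constant_unit) blast
    have orth: "(a *\<^sub>R T s + b *\<^sub>R N s) \<bullet> V = 0" if "s \<in> I" for s
      using V(2) W_eq that by simp
    have b: "b \<noteq> 0" by (rule orthogonal_axis_imp_ratio_ode(1)[OF ab V(1) orth])
    have ode: "deriv ratio s = a / b * (\<tau> s * ((ratio s)\<^sup>2 + b\<^sup>2))" if "s \<in> I" for s
      by (rule orthogonal_axis_imp_ratio_ode(2)[OF ab V(1) orth that])
    \<comment> \<open>\<open>W\<close> and \<open>- W\<close> have the same quotient \<open>a / b\<close>; choosing the one with nonnegative tangential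
      part puts the angle into the range of \<open>arcsin\<close>.\<close>
    define c where "c = (if a \<ge> 0 then b else - b)"
    have c: "\<bar>c\<bar> \<le> 1" "c \<noteq> 0" "c\<^sup>2 = b\<^sup>2" "\<bar>a\<bar> / c = a / b"
      using ab b power2_le_imp_le[of "\<bar>b\<bar>" 1] zero_le_power2[of a] by (auto simp: c_def)
    have "1 - c\<^sup>2 = a\<^sup>2" using ab c(3) by simp
    then have sc: "sin (arcsin c) = c" "cos (arcsin c) = \<bar>a\<bar>"
      using c(1) by (simp_all add: cos_arcsin abs_le_iff)
    show ?ode
    proof (intro bexI[of _ "arcsin c"] conjI ballI)
      show "arcsin c \<in> {- pi / 2..pi / 2}" using arcsin_bounded[of c] c(1) by auto
      show "arcsin c \<noteq> 0" using sc(1) c(2) by auto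
      fix s assume s: "s \<in> I"
      show "\<tau> s / ((\<kappa> s)\<^sup>2 + (sin (arcsin c))\<^sup>2 * (\<tau> s)\<^sup>2) * deriv ratio s = cot (arcsin c)"
        using ratio_ode_iff[OF s b, of a] ode[OF s] by (simp add: sc c cot_def)
    qed
  next
    assume ?ode
    then obtain \<theta> where \<theta>: "\<theta> \<in> {- pi / 2..pi / 2}" "\<theta> \<noteq> 0"
      and eq: "\<And>s. s \<in> I \<Longrightarrow>
        \<tau> s / ((\<kappa> s)\<^sup>2 + (sin \<theta>)\<^sup>2 * (\<tau> s)\<^sup>2) * deriv ratio s = cos \<theta> / sin \<theta>"
      unfolding cot_def by blast
    have sin: "sin \<theta> \<noteq> 0"
      using \<theta> sin_gt_zero[of \<theta>] sin_gt_zero[of "- \<theta>"] pi_gt_zero by (cases "\<theta> > 0") auto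
    have ode: "deriv ratio s = cos \<theta> / sin \<theta> * (\<tau> s * ((ratio s)\<^sup>2 + (sin \<theta>)\<^sup>2))" if "s \<in> I" for s
      using ratio_ode_iff[OF that sin] eq[OF that] by blast
    obtain V where V: "V \<noteq> 0" "\<And>s. s \<in> I \<Longrightarrow> (cos \<theta> *\<^sub>R T s + sin \<theta> *\<^sub>R N s) \<bullet> V = 0"
      using ratio_ode_imp_orthogonal_axis[of "cos \<theta>" "sin \<theta>"] sin ode by auto
    let ?W = "\<lambda>t. cos \<theta> *\<^sub>R T t + sin \<theta> *\<^sub>R N t"
    have "norm (?W s) = 1" if "s \<in> I" for s
      using that by (simp add: norm_eq_1 frame_inner inner_add_left inner_add_right
          power2_eq_square[symmetric])
    moreover have "osculating I \<alpha> ?W"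
      unfolding osculating_def by (intro ballI span_add span_scale span_base) auto
    ultimately show ?helix
      using F_constant_linear_combination V by blast
  qed
qed

end
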